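(* For every integer $n \geq 1$, $$\mathrm{ex}_{\mathcal P}(n,P_3^{\mathrm{ind}})=\begin{cases} \frac{6}{4}n, & n \equiv 0 \pmod 4,\\ \frac{6}{4}(n-1), & n \equiv 1 \pmod 4,\\ \frac{6}{4}(n-2)+1, & n\equiv 2 \pmod 4,\\ \frac{6}{4}(n-3)+3, & n \equiv 3 \pmod 4.\end{cases}$$ Moreover, the unique (up to isomorphism) extremal graph, i.e. the unique $n$-vertex planar $P_3^{\mathrm{ind}}$-free graph with this number of edges, is the disjoint union of $\lfloor \frac{n}{4}\rfloor$ copies of $K_4$ and, if $4\nmid n$, a clique on the remaining $n-4\lfloor \frac n4\rfloor$ vertices.
   Context: All graphs are finite and simple. $P_k$ denotes the path on $k$ vertices and $K_m$ the complete graph on $m$ vertices. A graph $G$ is $F^{\mathrm{ind}}$-free if it contains no induced subgraph isomorphic to $F$. The induced planar Turán number is $\mathrm{ex}_{\mathcal P}(n,F^{\mathrm{ind}}):=\max\{|E(G)| : G \text{ is an } n\text{-vertex planar graph that is } F^{\mathrm{ind}}\text{-free}\}$. *)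

theory Defs
  imports "HOL-Analysis.Analysis"
begin

datatype 'a ugraph = UGraph (verts: "'a set") (edges: "'a set set")

definition simple_graph :: "'a ugraph \<Rightarrow> bool" where
  "simple_graph G \<longleftrightarrow> finite (verts G) \<and> (\<forall>e\<in>edges G. e \<subseteq> verts G \<and> card e = 2)"

definition graph_iso :: "'a ugraph \<Rightarrow> 'b ugraph \<Rightarrow> bool" where
  "graph_iso G H \<longleftrightarrow> (\<exists>f. bij_betw f (verts G) (verts H) \<and> edges H = (\<lambda>e. f ` e) ` edges G)"

definition induced_subgraph :: "'a ugraph \<Rightarrow> 'a set \<Rightarrow> 'a ugraph" where
  "induced_subgraph G S = UGraph S {e \<in> edges G. e \<subseteq> S}"

definition ind_free :: "'b ugraph \<Rightarrow> 'a ugraph \<Rightarrow> bool" where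
  "ind_free F G \<longleftrightarrow> \<not> (\<exists>S \<subseteq> verts G. graph_iso F (induced_subgraph G S))"

definition path_graph :: "nat \<Rightarrow> nat ugraph" where
  "path_graph k = UGraph {..<k} {{i, Suc i} | i. Suc i < k}"

definition complete_graph :: "nat \<Rightarrow> nat ugraph" where
  "complete_graph m = UGraph {..<m} {e. e \<subseteq> {..<m} \<and> card e = 2}"

definition disjoint_union :: "'a ugraph list \<Rightarrow> (nat \<times> 'a) ugraph" where
  "disjoint_union Gs = UGraph
     (\<Union>i<length Gs. Pair i ` verts (Gs ! i))
     (\<Union>i<length Gs. (\<lambda>e. Pair i ` e) ` edges (Gs ! i))"

text \<open>A drawing in the plane (identified with the complex numbers): vertices are distinct points,
  every edge is a simple arc joining its end vertices and passing through no other vertex, and two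
  distinct edges meet at most in common end vertices.\<close>

definition plane_drawing :: "'a ugraph \<Rightarrow> ('a \<Rightarrow> complex) \<Rightarrow> ('a set \<Rightarrow> real \<Rightarrow> complex) \<Rightarrow> bool" where
  "plane_drawing G p c \<longleftrightarrow>
     inj_on p (verts G) \<and>
     (\<forall>e\<in>edges G. arc (c e) \<and> {pathstart (c e), pathfinish (c e)} = p ` e \<and>
        path_image (c e) \<inter> p ` verts G = p ` e) \<and>
     (\<forall>e\<in>edges G. \<forall>e'\<in>edges G. e \<noteq> e' \<longrightarrow>
        path_image (c e) \<inter> path_image (c e') = p ` (e \<inter> e'))"

definition planar :: "'a ugraph \<Rightarrow> bool" where
  "planar G \<longleftrightarrow> (\<exists>p c. plane_drawing G p c)"

definition planar_ind_free_graphs :: "nat \<Rightarrow> 'b ugraph \<Rightarrow> 'a ugraph set" where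
  "planar_ind_free_graphs n F =
     {G. simple_graph G \<and> card (verts G) = n \<and> planar G \<and> ind_free F G}"

text \<open>Every finite graph is isomorphic to one whose vertices are natural numbers, so it suffices
  to let the maximum range over those. The set of edge numbers is finite, being bounded by
  \<open>n choose 2\<close>; \<open>Max\<close> is meaningful whenever some such graph exists.\<close>

definition ex_planar_ind :: "nat \<Rightarrow> 'b ugraph \<Rightarrow> nat" where
  "ex_planar_ind n F =
     Max ((\<lambda>G. card (edges G)) ` (planar_ind_free_graphs n F :: nat ugraph set))"

definition extremal_graph :: "nat \<Rightarrow> 'b ugraph \<Rightarrow> 'a ugraph \<Rightarrow> bool" where
  "extremal_graph n F G \<longleftrightarrow>
     G \<in> planar_ind_free_graphs n F \<and> card (edges G) = ex_planar_ind n F"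

definition K4_union :: "nat \<Rightarrow> (nat \<times> nat) ugraph" where
  "K4_union n = disjoint_union
     (replicate (n div 4) (complete_graph 4) @
      (if 4 dvd n then [] else [complete_graph (n - 4 * (n div 4))]))"

end

theory Submission
  imports Defs
begin

text \<open>
  An induced-\<open>P\<^sub>3\<close>-free graph is a disjoint union of cliques, and planarity limits the cliques to size
  \<open>4\<close>. If \<open>k\<^sub>s\<close> cliques have size \<open>s\<close>, then \<open>3 n - 2 m = 3 k\<^sub>1 + 4 k\<^sub>2 + 3 k\<^sub>3\<close>, which forces all but at most
  one clique to be a \<open>K\<^sub>4\<close> when the number \<open>m\<close> of edges is maximal.

  Nonplanarity of \<open>K\<^sub>5\<close> is derived from the theta-curve form of the Jordan curve theorem. If \<open>d\<close> lies
  inside the triangle \<open>abc\<close>, then so does \<open>e\<close>, and the arcs from \<open>d\<close> cut this inside into three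
  regions, each of whose closures misses one of \<open>a, b, c\<close>; the region of \<open>e\<close> cannot be left towards
  that vertex. If \<open>d\<close> and \<open>e\<close> lie outside, an inversion about a point inside the triangle reduces to
  the first case.
\<close>

section \<open>Nonplanarity of the complete graph on five vertices\<close>

text \<open>Vertices are points of the plane, and each edge carries one arc per direction with a
  common image, so that arcs can be concatenated along any route without explicit reversals.\<close>

definition arc_system :: "complex set \<Rightarrow> (complex \<Rightarrow> complex \<Rightarrow> real \<Rightarrow> complex) \<Rightarrow> bool" where
  "arc_system V A \<longleftrightarrow>
     (\<forall>v\<in>V. \<forall>w\<in>V. v \<noteq> w \<longrightarrow>
        arc (A v w) \<and> pathstart (A v w) = v \<and> pathfinish (A v w) = w \<and>
        path_image (A v w) = path_image (A w v) \<and> path_image (A v w) \<inter> V = {v, w}) \<and>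
     (\<forall>v\<in>V. \<forall>w\<in>V. \<forall>x\<in>V. \<forall>y\<in>V. v \<noteq> w \<longrightarrow> x \<noteq> y \<longrightarrow> {v, w} \<noteq> {x, y} \<longrightarrow>
        path_image (A v w) \<inter> path_image (A x y) = {v, w} \<inter> {x, y})"

lemma arc_systemD:
  assumes "arc_system V A" "v \<in> V" "w \<in> V" "v \<noteq> w"
  shows "arc (A v w)" "pathstart (A v w) = v" "pathfinish (A v w) = w"
    "path_image (A v w) = path_image (A w v)" "path_image (A v w) \<inter> V = {v, w}"
  using assms by (simp_all add: arc_system_def)

lemma arc_system_Int:
  assumes "arc_system V A" "v \<in> V" "w \<in> V" "x \<in> V" "y \<in> V" "v \<noteq> w" "x \<noteq> y" "{v, w} \<noteq> {x, y}"
  shows "path_image (A v w) \<inter> path_image (A x y) = {v, w} \<inter> {x, y}"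
  using assms(1) unfolding arc_system_def
  by (elim conjE, drule_tac bspec[OF _ assms(2)], drule_tac bspec[OF _ assms(2)])
     (use assms(3-) in \<open>simp del: Int_insert_left Int_insert_right\<close>)

section \<open>Arcs and the insides of closed curves\<close>

lemma inside_arc_transfer:
  assumes "arc g" "path_image g \<inter> S = {}" "pathstart g \<in> inside S"
  shows "pathfinish g \<in> inside S"
proof -
  have "connected_component (- S) (pathstart g) (pathfinish g)"
    using assms(1,2) unfolding connected_component_def
    by (intro exI[of _ "path_image g"]) (auto simp: arc_imp_path connected_path_image)
  then show ?thesis
    using assms(3) inside_same_component by blast
qed

text \<open>What remains is the image of a half-open interval. An arc that touches a closed curve
  only at its end can thus be assigned, without that end, to one side of the curve.\<close>

lemma connected_arc_minus_finish:
  assumes "arc g"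
  shows "connected (path_image g - {pathfinish g})"
proof -
  have "path_image g - {pathfinish g} = g ` {0..<1}"
  proof -
    have "g t \<noteq> g 1" if "0 \<le> t" "t < 1" for t
      using arcD[OF assms, of t 1] that by auto
    moreover have "{0..1::real} = insert 1 {0..<1}" by auto
    ultimately show ?thesis
      by (auto simp: path_image_def pathfinish_def)
  qed
  moreover have "connected (g ` {0..<1})"
    using assms continuous_on_subset[of "{0..1}" g "{0..<1}"]
    by (intro connected_continuous_image) (auto simp: arc_def path_def subset_iff)
  ultimately show ?thesis by simp
qed

text \<open>The theta-curve theorem is applied twice: the route from \<open>a\<close> over
  \<open>d\<close> to \<open>b\<close> cuts the inside of the triangle, and the arc from
  \<open>d\<close> to \<open>c\<close> then cuts the part bounded by the quadrilateral
  \<open>a\<close>, \<open>c\<close>, \<open>b\<close>, \<open>d\<close>.\<close>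

lemma triangle_inside_False:
  assumes A: "arc_system V A" and V: "{a, b, c, d, e} \<subseteq> V" and dist: "distinct [a, b, c, d, e]"
    and d: "d \<in> inside (path_image (A a b) \<union> (path_image (A a c) \<union> path_image (A c b)))"
  shows False
proof -
  define I where "I v w = path_image (A v w)" for v w
  have arc: "arc (A v w)" "pathstart (A v w) = v" "pathfinish (A v w) = w" "I v w = I w v"
    "x \<in> V \<Longrightarrow> x \<in> I v w \<longleftrightarrow> x = v \<or> x = w" if "v \<in> V" "w \<in> V" "v \<noteq> w" for v w x
    using arc_systemD[OF A that] unfolding I_def by blast+
  have meet: "I v w \<inter> I x y = {v, w} \<inter> {x, y}"
    if "v \<in> V" "w \<in> V" "x \<in> V" "y \<in> V" "v \<noteq> w" "x \<noteq> y" "{v, w} \<noteq> {x, y}" for v w x y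
    using arc_system_Int[OF A that] unfolding I_def .
  have join: "arc (A x y +++ A y z)" "path_image (A x y +++ A y z) = I x y \<union> I y z"
      "pathstart (A x y +++ A y z) = x" "pathfinish (A x y +++ A y z) = z"
    if "x \<in> V" "y \<in> V" "z \<in> V" "x \<noteq> y" "y \<noteq> z" "x \<noteq> z" for x y z
  proof -
    have "I x y \<inter> I y z = {x, y} \<inter> {y, z}"
      using that by (intro meet) (auto simp: doubleton_eq_iff)
    then show "arc (A x y +++ A y z)"
      using that arc(1)[of x y] arc(1)[of y z] arc(2)[of y z] arc(3)[of x y]
      by (intro arc_join) (auto simp: I_def)
  qed (use that arc(2)[of x y] arc(2)[of y z] arc(3)[of x y] arc(3)[of y z]
       in \<open>simp_all add: path_image_join I_def\<close>)
  have transfer: "w \<in> inside S" if "v \<in> V" "w \<in> V" "v \<noteq> w" "I v w \<inter> S = {}" "v \<in> inside S" for v w S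
    using inside_arc_transfer[of "A v w" S] arc[of v w] that by (auto simp: I_def)
  have inV: "a \<in> V" "b \<in> V" "c \<in> V" "d \<in> V" "e \<in> V"
    using V by auto
  have ne: "a \<noteq> b" "a \<noteq> c" "a \<noteq> d" "a \<noteq> e" "b \<noteq> c" "b \<noteq> d" "b \<noteq> e" "c \<noteq> d" "c \<noteq> e" "d \<noteq> e"
    "b \<noteq> a" "c \<noteq> a" "d \<noteq> a" "e \<noteq> a" "c \<noteq> b" "d \<noteq> b" "e \<noteq> b" "d \<noteq> c" "e \<noteq> c" "e \<noteq> d"
    using dist by auto
  have mt: "I v w \<inter> I x y = {v, w} \<inter> {x, y}"
    if "v \<in> V" "w \<in> V" "x \<in> V" "y \<in> V" "v \<noteq> w" "x \<noteq> y" "v \<noteq> x \<and> v \<noteq> y \<or> w \<noteq> x \<and> w \<noteq> y"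
    for v w x y
    using that by (intro meet) (auto simp: doubleton_eq_iff)
  let ?abc = "I a b \<union> (I a c \<union> I c b)"
  let ?abd = "I a b \<union> (I a d \<union> I d b)"
  let ?acbd = "(I a c \<union> I c b) \<union> (I a d \<union> I d b)"
  have din: "d \<in> inside ?abc"
    using d by (simp add: I_def)
  \<comment> \<open>The arc from \<open>d\<close> to \<open>e\<close> avoids all three sides of the
    triangle.\<close>
  have ein: "e \<in> inside ?abc"
    by (rule transfer[of d]) (use din ne inV in \<open>auto simp: Int_Un_distrib mt\<close>)
  have dI: "d \<in> I a d" "d \<in> I d b"
    using arc(5)[of a d] arc(5)[of d b] ne inV by auto
  \<comment> \<open>The cutting curve enters the inside of the triangle because it passes through
    \<open>d\<close>.\<close>
  obtain split_abc: "inside ?abd \<union> inside ?acbd \<union> ((I a d \<union> I d b) - {a, b}) = inside ?abc"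
  proof (rule split_inside_simple_closed_curve[of "A a b" a b "A a c +++ A c b" "A a d +++ A d b"])
    show "path_image (A a b) \<inter> path_image (A a c +++ A c b) = {a, b}"
      using ne inV by (auto simp: join Int_Un_distrib mt simp flip: I_def)
    show "path_image (A a b) \<inter> path_image (A a d +++ A d b) = {a, b}"
      using ne inV by (auto simp: join Int_Un_distrib mt simp flip: I_def)
    show "path_image (A a c +++ A c b) \<inter> path_image (A a d +++ A d b) = {a, b}"
      using ne inV by (auto simp: join Int_Un_distrib Int_Un_distrib2 mt simp flip: I_def)
    show "path_image (A a d +++ A d b) \<inter> inside (path_image (A a b) \<union> path_image (A a c +++ A c b)) \<noteq> {}"
      using ne inV din dI by (auto simp: join simp flip: I_def)
  qed (use ne inV arc(1-3) join in \<open>auto simp: arc_imp_simple_path simp flip: I_def\<close>)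
  have c_notin: "c \<notin> inside ?abd"
    using split_abc arc(5)[of a c] ne inV inside_no_overlap[of ?abc] by blast
  \<comment> \<open>The arc from \<open>e\<close> to \<open>c\<close> avoids \<open>?abd\<close>, so
    it would carry \<open>c\<close> inside that curve as well.\<close>
  have "e \<notin> inside ?abd"
  proof
    assume "e \<in> inside ?abd"
    then have "c \<in> inside ?abd"
      by (rule transfer[of e, rotated -1]) (use ne inV in \<open>auto simp: Int_Un_distrib mt\<close>)
    with c_notin show False ..
  qed
  moreover have "e \<notin> I a d" "e \<notin> I d b"
    using arc(5)[of a d] arc(5)[of d b] ne inV by auto
  ultimately have ein2: "e \<in> inside ?acbd"
    using split_abc ein by blast
  \<comment> \<open>The open arc from \<open>d\<close> to \<open>c\<close> is shown below to lie
    inside the quadrilateral; being nonempty, it witnesses that the second cut enters that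
    region.\<close>
  have dc_ne: "I d c - {d, c} \<noteq> {}"
    using nonempty_simple_path_endless[of "A d c"] arc[of d c] ne inV
    by (auto simp: arc_imp_simple_path I_def)
  have "connected (I d c - {c})"
    using connected_arc_minus_finish[of "A d c"] arc[of d c] ne inV by (auto simp: I_def)
  moreover have "I d c \<inter> ?abc = {c}"
    using ne inV by (auto simp: Int_Un_distrib mt)
  moreover have dc: "d \<in> I d c" "c \<in> I d c"
    using arc(5)[of d c] ne inV by auto
  \<comment> \<open>Without \<open>c\<close>, its only point on the triangle, the arc is connected
    and contains \<open>d\<close>, which lies inside.\<close>
  ultimately have dc_abc: "I d c - {c} \<subseteq> inside ?abc"
    using inside_outside_intersect_connected[of "I d c - {c}" ?abc] din ne inV
      inside_Un_outside[of ?abc] by blast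
  have "connected (I d c - {d})"
    using connected_arc_minus_finish[of "A c d"] arc[of c d] arc(4)[of d c] ne inV by (auto simp: I_def)
  moreover have "I d c \<inter> ?abd = {d}"
    using ne inV by (auto simp: Int_Un_distrib mt)
  \<comment> \<open>The same argument from the other end: without \<open>d\<close> the arc avoids
    \<open>?abd\<close> and contains \<open>c\<close>, which is not inside.\<close>
  ultimately have "(I d c - {d}) \<inter> inside ?abd = {}"
    using inside_outside_intersect_connected[of "I d c - {d}" ?abd] c_notin dc ne inV
      inside_Un_outside[of ?abd] by blast
  then have dc_acbd: "I d c - {d, c} \<subseteq> inside ?acbd"
    using dc_abc split_abc \<open>I d c \<inter> ?abd = {d}\<close> by blast
  let ?dac = "(I d a \<union> I a c) \<union> I d c"
  let ?dbc = "(I d b \<union> I b c) \<union> I d c"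
  have eq: "(I d a \<union> I a c) \<union> (I d b \<union> I b c) = ?acbd"
    using arc(4)[of d a] arc(4)[of b c] ne inV by auto
  obtain split_acbd: "inside ?dac \<union> inside ?dbc \<union> (I d c - {d, c}) = inside ?acbd"
  proof (rule split_inside_simple_closed_curve[of "A d a +++ A a c" d c "A d b +++ A b c" "A d c"])
    show "path_image (A d a +++ A a c) \<inter> path_image (A d b +++ A b c) = {d, c}"
      using ne inV by (auto simp: join Int_Un_distrib Int_Un_distrib2 mt simp flip: I_def)
    show "path_image (A d a +++ A a c) \<inter> path_image (A d c) = {d, c}"
      using ne inV by (auto simp: join Int_Un_distrib2 mt simp flip: I_def)
    show "path_image (A d b +++ A b c) \<inter> path_image (A d c) = {d, c}"
      using ne inV by (auto simp: join Int_Un_distrib2 mt simp flip: I_def)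
    show "path_image (A d c) \<inter> inside (path_image (A d a +++ A a c) \<union> path_image (A d b +++ A b c)) \<noteq> {}"
      using ne inV dc_acbd dc_ne eq by (auto simp: join simp flip: I_def)
  qed (use ne inV arc(1-3) join eq in \<open>auto simp: arc_imp_simple_path simp flip: I_def\<close>)
  have ab_notin: "a \<notin> inside ?acbd" "b \<notin> inside ?acbd"
    using arc(5)[of a c] arc(5)[of d b] ne inV inside_no_overlap[of ?acbd] by blast+
  have "e \<notin> I d c"
    using arc(5)[of d c] ne inV by auto
  \<comment> \<open>The first region misses the vertex \<open>b\<close>, the second misses
    \<open>a\<close>. The arc from \<open>e\<close> to the missing vertex would put that vertex
    inside the region and hence inside the quadrilateral, on whose boundary it lies.\<close>
  then consider "e \<in> inside ?dac" | "e \<in> inside ?dbc"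
    using ein2 split_acbd by blast
  then show False
  proof cases
    case 1
    then have "b \<in> inside ?dac"
      by (rule transfer[of e, rotated -1]) (use ne inV in \<open>auto simp: Int_Un_distrib mt\<close>)
    then show False using split_acbd ab_notin by blast
  next
    case 2
    then have "a \<in> inside ?dbc"
      by (rule transfer[of e, rotated -1]) (use ne inV in \<open>auto simp: Int_Un_distrib mt\<close>)
    then show False using split_acbd ab_notin by blast
  qed
qed

text \<open>Inversion about \<open>z0\<close> sends infinity to \<open>0\<close> and the
  neighbourhood of \<open>z0\<close> to infinity. If \<open>f z0 d\<close> were not inside the image
  curve, the images of both sides would have to avoid its inside, leaving that inside empty, against
  the Jordan curve theorem.\<close>

lemma inversion_swaps_outside:
  fixes g :: "real \<Rightarrow> complex"
  defines "f \<equiv> \<lambda>z0 z. inverse (z - z0)"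
  assumes g: "simple_path g" "pathfinish g = pathstart g"
    and z0: "z0 \<in> inside (path_image g)" and d: "d \<in> outside (path_image g)"
  shows "f z0 d \<in> inside (f z0 ` path_image g)"
proof (rule ccontr)
  assume contra: "f z0 d \<notin> inside (f z0 ` path_image g)"
  define C where "C = path_image g"
  define h where "h = f z0"
  have h: "h z = inverse (z - z0)" for z
    by (simp add: h_def f_def)
  have inj: "h x = h y \<longleftrightarrow> x = y" for x y
    by (simp add: h)
  have J: "open (inside C)" "connected (inside C)" "connected (outside C)" "\<not> bounded (outside C)"
    using Jordan_inside_outside[OF g] by (simp_all add: C_def)
  have z0C: "z0 \<in> inside C" "z0 \<notin> C" "z0 \<notin> outside C"
    using z0 inside_no_overlap[of C] inside_Int_outside[of C] unfolding C_def by blast+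
  have disj: "x \<notin> C" if "x \<in> inside C \<or> x \<in> outside C" for x
    using that inside_no_overlap[of C] outside_no_overlap[of C] by blast
  have cont: "continuous_on S h" if "z0 \<notin> S" for S
    unfolding h using that by (intro continuous_intros) auto
  have D: "inside (h ` C) \<noteq> {}" "bounded (inside (h ` C))"
  proof -
    have "simple_path (h \<circ> g)"
      using g(1) cont[of "path_image g"] z0C(2)
      by (intro simple_path_continuous_image) (auto simp: C_def inj inj_on_def)
    moreover have "pathfinish (h \<circ> g) = pathstart (h \<circ> g)"
      using g(2) by (simp add: pathfinish_def pathstart_def)
    ultimately show "inside (h ` C) \<noteq> {}" "bounded (inside (h ` C))"
      using Jordan_inside_outside[of "h \<circ> g"] by (simp_all add: C_def path_image_compose)
  qed
  have "0 \<notin> h ` C"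
    using z0C by (auto simp: h)
  \<comment> \<open>\<open>0\<close> plays the image of infinity. \<open>?K\<close> is the image of
    the outside with this point added, \<open>?N\<close> the image of the inside punctured at
    \<open>z0\<close>; together they fill the complement of the image curve.\<close>
  let ?K = "insert 0 (h ` outside C)" and ?N = "h ` (inside C - {z0})"
  have "0 \<in> closure (h ` outside C)"
    unfolding closure_approachable
  proof (intro allI impI)
    fix \<epsilon> :: real assume "\<epsilon> > 0"
    obtain z where z: "z \<in> outside C" "norm z > norm z0 + 1 / \<epsilon>"
      using J(4) unfolding bounded_iff by (metis not_le)
    have "norm (z - z0) > 1 / \<epsilon>"
      using z(2) norm_triangle_ineq2[of z z0] by linarith
    then have "inverse (norm (z - z0)) < inverse (1 / \<epsilon>)"
      using \<open>\<epsilon> > 0\<close> by (intro less_imp_inverse_less) auto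
    then have "norm (h z) < \<epsilon>"
      by (simp add: h norm_inverse)
    then show "\<exists>y\<in>h ` outside C. dist y 0 < \<epsilon>"
      using z(1) by auto
  qed
  moreover have "connected (h ` outside C)"
    using J(3) cont z0C by (intro connected_continuous_image) auto
  ultimately have "connected ?K"
    by (intro connected_intermediate_closure[of "h ` outside C" ?K]) (auto intro: closure_subset[THEN subsetD])
  moreover have "?K \<inter> h ` C = {}"
    using \<open>0 \<notin> h ` C\<close> disj by (auto simp: inj)
  moreover have "h d \<in> ?K" "h d \<in> outside (h ` C)"
  proof -
    show "h d \<in> ?K"
      using d by (simp add: C_def)
    have "h d \<notin> h ` C"
      using d disj by (auto simp: inj C_def)
    then show "h d \<in> outside (h ` C)"
      using contra inside_Un_outside[of "h ` C"] unfolding C_def h_def by blast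
  qed
  ultimately have K: "?K \<inter> inside (h ` C) = {}"
    using inside_outside_intersect_connected[of ?K "h ` C"] by blast
  have "connected ?N"
    using J cont by (intro connected_continuous_image connected_open_delete) auto
  moreover have N: "?N \<inter> h ` C = {}"
    using disj by (auto simp: inj)
  \<comment> \<open>Points of the inside that approach \<open>z0\<close> have arbitrarily large
    images. Being connected and unbounded, \<open>?N\<close> cannot meet the bounded inside of the
    image curve.\<close>
  moreover have "\<not> bounded ?N"
  proof
    assume "bounded ?N"
    then obtain B where B: "B > 0" "\<And>z. z \<in> inside C \<Longrightarrow> z \<noteq> z0 \<Longrightarrow> norm (h z) \<le> B"
      by (auto simp: bounded_pos)
    obtain r where r: "r > 0" "ball z0 r \<subseteq> inside C"
      using J(1) z0C(1) openE by blast
    \<comment> \<open>The first bound keeps \<open>z0 + t\<close> in the ball, the second makes the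
      norm of its image, \<open>1 / t\<close>, exceed \<open>B\<close>.\<close>
    define t where "t = min (r / 2) (1 / (2 * B))"
    have t: "0 < t" "t < r" "t * B < 1"
      using r B by (auto simp: t_def min_def field_simps)
    let ?z = "z0 + complex_of_real t"
    have "?z \<in> inside C" "?z \<noteq> z0"
      using r t by (auto simp: dist_norm)
    then have "norm (h ?z) \<le> B" by (rule B)
    then show False
      using t by (simp add: h norm_inverse norm_divide field_simps)
  qed
  ultimately have N: "?N \<inter> inside (h ` C) = {}"
    using inside_outside_intersect_connected[of ?N "h ` C"] D(2) bounded_subset[of "inside (h ` C)" ?N]
      inside_Un_outside[of "h ` C"] by blast
  obtain w where w: "w \<in> inside (h ` C)"
    using D by auto
  then have "w \<noteq> 0" using K by auto
  then have "w = h (z0 + inverse w)" "z0 + inverse w \<noteq> z0"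
    by (simp_all add: h)
  moreover have "w \<notin> h ` C"
    using w inside_no_overlap[of "h ` C"] by blast
  ultimately show False
    using w K N inside_Un_outside[of C] by blast
qed

text \<open>The triangle case excludes \<open>d\<close> and \<open>e\<close> from the inside of the
  triangle \<open>a\<close>, \<open>b\<close>, \<open>c\<close>. Inverting about a point there moves
  \<open>d\<close> inside the image triangle, provided that no arc of the system passes through the
  centre. For this check \<open>V\<close> consists of exactly the five points.\<close>

lemma no_arc_system_five:
  assumes A: "arc_system V A" and V: "V = {a, b, c, d, e}" and dist: "distinct [a, b, c, d, e]"
  shows False
proof -
  define I where "I v w = path_image (A v w)" for v w
  let ?C = "I a b \<union> (I a c \<union> I c b)"
  have inV: "a \<in> V" "b \<in> V" "c \<in> V" "d \<in> V" "e \<in> V"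
    using V by auto
  have ne: "a \<noteq> b" "a \<noteq> c" "a \<noteq> d" "a \<noteq> e" "b \<noteq> c" "b \<noteq> d" "b \<noteq> e" "c \<noteq> d" "c \<noteq> e" "d \<noteq> e"
    "b \<noteq> a" "c \<noteq> a" "d \<noteq> a" "e \<noteq> a" "c \<noteq> b" "d \<noteq> b" "e \<noteq> b" "d \<noteq> c" "e \<noteq> c" "e \<noteq> d"
    using dist by auto
  have arc: "arc (A v w)" "pathstart (A v w) = v" "pathfinish (A v w) = w" "I v w = I w v"
    "x \<in> V \<Longrightarrow> x \<in> I v w \<longleftrightarrow> x = v \<or> x = w" if "v \<in> V" "w \<in> V" "v \<noteq> w" for v w x
    using arc_systemD[OF A that] unfolding I_def by blast+
  have meet: "I v w \<inter> I x y = {v, w} \<inter> {x, y}"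
    if "v \<in> V" "w \<in> V" "x \<in> V" "y \<in> V" "v \<noteq> w" "x \<noteq> y" "v \<noteq> x \<and> v \<noteq> y \<or> w \<noteq> x \<and> w \<noteq> y" for v w x y
    using arc_system_Int[OF A that(1-6)] that(7) unfolding I_def by (metis doubleton_eq_iff)
  have dC: "d \<notin> ?C" and eC: "e \<notin> ?C"
    using ne inV by (auto simp: arc(5))
  have dnot: "d \<notin> inside ?C"
    using triangle_inside_False[OF A _ dist] V by (auto simp: I_def)
  have enot: "e \<notin> inside ?C"
    using triangle_inside_False[OF A, of a b c e d] ne V by (auto simp: I_def)
  obtain g where g: "simple_path g" "pathfinish g = pathstart g" "path_image g = ?C"
  proof
    have m: "I a c \<inter> I c b = {c}" "(I a c \<union> I c b) \<inter> I b a = {a, b}"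
      using ne inV by (auto simp: Int_Un_distrib2 meet)
    have "arc (A a c +++ A c b)"
      using ne inV m(1) by (intro arc_join) (auto simp: arc(1-3) simp flip: I_def)
    then show "simple_path ((A a c +++ A c b) +++ A b a)"
      using ne inV m(2) by (intro simple_path_join_loop) (auto simp: arc(1-3) path_image_join simp flip: I_def)
    show "path_image ((A a c +++ A c b) +++ A b a) = ?C"
      using ne inV arc(4)[of b a] by (auto simp: arc(1-3) path_image_join simp flip: I_def)
  qed (use ne inV in \<open>auto simp: arc(2,3)\<close>)
  obtain z0 where z0: "z0 \<in> inside ?C"
    using Jordan_inside_outside[OF g(1,2)] g(3) by auto
  \<comment> \<open>Such an arc starts outside the triangle and meets it at most in its final point,
    so it never enters the inside.\<close>
  have from_out: "I v w \<inter> inside ?C = {}"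
    if v: "v \<in> {d, e}" and w: "w \<in> V" "v \<noteq> w" for v w
  proof -
    have vV: "v \<in> V" "v \<in> outside ?C" "v \<noteq> a" "v \<noteq> b" "v \<noteq> c"
      using v inV ne dC eC dnot enot inside_Un_outside[of ?C] by blast+
    have "connected (I v w - {w})"
      using connected_arc_minus_finish[of "A v w"] arc[of v w] vV w by (auto simp: I_def)
    moreover have "I v w \<inter> ?C \<subseteq> {w}"
      using vV inV w ne by (auto simp: Int_Un_distrib meet)
    moreover have "v \<in> I v w"
      using vV w by (simp add: arc(5))
    ultimately have "(I v w - {w}) \<inter> inside ?C = {}"
      using inside_outside_intersect_connected[of "I v w - {w}" ?C] vV w by blast
    moreover have "w \<notin> inside ?C"
    proof -
      have "w \<in> ?C \<or> w = d \<or> w = e"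
        using w V ne inV by (auto simp: arc(5))
      then show ?thesis
        using dnot enot inside_no_overlap[of ?C] by blast
    qed
    ultimately show ?thesis by blast
  qed
  \<comment> \<open>An arc between two of \<open>a\<close>, \<open>b\<close>, \<open>c\<close> is a
    side of the triangle; any other arc has \<open>d\<close> or \<open>e\<close> as an end.\<close>
  have avoid: "I v w \<inter> inside ?C = {}" if "v \<in> V" "w \<in> V" "v \<noteq> w" for v w
  proof (cases "v \<in> {d, e} \<or> w \<in> {d, e}")
    case True
    then show ?thesis
      using from_out[of v w] from_out[of w v] that arc(4)[of v w] by auto
  next
    case False
    then have "I v w \<subseteq> ?C"
      using that V ne inV arc(4)[of b a] arc(4)[of c a] arc(4)[of c b] by auto
    then show ?thesis
      using inside_no_overlap[of ?C] by blast
  qed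
  define f where "f z = inverse (z - z0)" for z
  \<comment> \<open>Since \<open>inverse 0 = 0\<close>, this undoes \<open>f\<close> at every point,
    even at \<open>z0\<close>. It is used to index the transported arcs by the image points.\<close>
  define f' where "f' z = z0 + inverse z" for z
  have ff: "f' (f z) = z" for z
    by (simp add: f_def f'_def)
  have inj: "f x = f y \<longleftrightarrow> x = y" for x y
    by (simp add: f_def)
  have fImg: "f ` S \<inter> f ` T = f ` (S \<inter> T)" for S T
    by (auto simp: inj)
  let ?B = "\<lambda>x y. f \<circ> A (f' x) (f' y)"
  have farc: "arc (f \<circ> A v w)" if "v \<in> V" "w \<in> V" "v \<noteq> w" for v w
  proof -
    have "z0 \<notin> path_image (A v w)"
      using avoid[OF that] z0 by (auto simp: I_def)
    then have "continuous_on (path_image (A v w)) f"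
      unfolding f_def by (intro continuous_intros) auto
    then show ?thesis
      using arc(1)[OF that] by (auto simp: arc_def path_continuous_image inj_on_def inj)
  qed
  have B: "arc_system (f ` V) ?B"
    unfolding arc_system_def
  proof (intro conjI ballI impI; elim imageE; simp only: ff path_image_compose fImg pathstart_compose pathfinish_compose)
    fix v w assume vw: "f v \<noteq> f w" "v \<in> V" "w \<in> V"
    then have "v \<noteq> w" by auto
    note vw' = vw(2,3) this
    show "arc (f \<circ> A v w)"
      by (rule farc[OF vw'])
    show "f (pathstart (A v w)) = f v" "f (pathfinish (A v w)) = f w"
      "f ` path_image (A v w) = f ` path_image (A w v)"
      using arc_systemD[OF A vw'] by simp_all
    show "f ` (path_image (A v w) \<inter> V) = {f v, f w}"
      using arc_systemD(5)[OF A vw'] by simp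
  next
    fix v w x y
    assume vw: "f v \<noteq> f w" "f x \<noteq> f y" "{f v, f w} \<noteq> {f x, f y}" "v \<in> V" "w \<in> V" "x \<in> V" "y \<in> V"
    then have "path_image (A v w) \<inter> path_image (A x y) = {v, w} \<inter> {x, y}"
      by (intro arc_system_Int[OF A]) auto
    then have "f ` (path_image (A v w) \<inter> path_image (A x y)) = f ` {v, w} \<inter> f ` {x, y}"
      by (simp only: fImg)
    then show "f ` (path_image (A v w) \<inter> path_image (A x y)) = {f v, f w} \<inter> {f x, f y}"
      by (simp only: image_insert image_empty)
  qed
  have "f d \<in> inside (f ` path_image g)"
    unfolding f_def
  proof (rule inversion_swaps_outside[OF g(1,2)])
    show "d \<in> outside (path_image g)"
      using dC dnot inside_Un_outside[of ?C] unfolding g(3) by blast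
  qed (use z0 g(3) in simp)
  then have "f d \<in> inside (path_image (?B (f a) (f b)) \<union>
      (path_image (?B (f a) (f c)) \<union> path_image (?B (f c) (f b))))"
    by (simp add: g(3) ff image_Un path_image_compose I_def)
  then show False
    by (rule triangle_inside_False[OF B, rotated -1, where e = "f e"])
       (use V ne in \<open>auto simp: inj\<close>)
qed

section \<open>Graphs without induced paths on three vertices\<close>

text \<open>Closed neighbourhoods: once adjacency is transitive, these are the vertex sets of the
  components, and each is a clique.\<close>

definition nbhd :: "'a ugraph \<Rightarrow> 'a \<Rightarrow> 'a set" where
  "nbhd G v = {u \<in> verts G. u = v \<or> {u, v} \<in> edges G}"

lemma edge_doubleton:
  assumes "simple_graph G" "e \<in> edges G"
  obtains u v where "e = {u, v}" "u \<noteq> v" "u \<in> verts G" "v \<in> verts G"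
proof -
  have "e \<subseteq> verts G" "card e = 2"
    using assms by (auto simp: simple_graph_def)
  then show ?thesis
    using that unfolding card_2_iff by auto
qed

lemma edge_verts:
  assumes "simple_graph G" "{u, v} \<in> edges G"
  shows "u \<in> verts G" "v \<in> verts G" "u \<noteq> v"
  using assms by (force simp: simple_graph_def)+

lemma edges_path_graph_3: "edges (path_graph 3) = {{0, 1}, {1, 2}}"
proof -
  have "{{i, Suc i} | i. Suc i < 3} = (\<lambda>i. {i, Suc i}) ` {0, 1}"
    by (auto simp: less_Suc_eq numeral_3_eq_3)
  then show ?thesis
    by (simp add: path_graph_def numeral_2_eq_2)
qed

lemma verts_path_graph_3: "verts (path_graph 3) = {0, 1, 2}"
  by (auto simp: path_graph_def)

text \<open>An induced copy of the path is a triple of vertices spanning exactly two edges, so its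
  absence means that adjacency is transitive on distinct vertices.\<close>

lemma ind_free_path_3_iff:
  assumes G: "simple_graph G"
  shows "ind_free (path_graph 3) G \<longleftrightarrow>
    (\<forall>a b c. {a, b} \<in> edges G \<longrightarrow> {b, c} \<in> edges G \<longrightarrow> a \<noteq> c \<longrightarrow> {a, c} \<in> edges G)"
proof (intro iffI allI impI)
  fix a b c
  assume free: "ind_free (path_graph 3) G" and ab: "{a, b} \<in> edges G" and bc: "{b, c} \<in> edges G" and "a \<noteq> c"
  show "{a, c} \<in> edges G"
  proof (rule ccontr)
    assume ac: "{a, c} \<notin> edges G"
    define f :: "nat \<Rightarrow> 'a" where "f = (\<lambda>i. if i = 0 then a else if i = 1 then b else c)"
    have ne: "a \<noteq> b" "b \<noteq> c" and S: "{a, b, c} \<subseteq> verts G"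
      using edge_verts[OF G ab] edge_verts[OF G bc] by auto
    have "e \<in> {{a, b}, {b, c}}" if e: "e \<in> edges G" "e \<subseteq> {a, b, c}" for e
    proof -
      obtain u v where "e = {u, v}" "u \<noteq> v"
        using edge_doubleton[OF G e(1)] by metis
      then show ?thesis
        using e ac by (auto simp: insert_commute)
    qed
    then have "{e \<in> edges G. e \<subseteq> {a, b, c}} = {{a, b}, {b, c}}"
      using ab bc by auto
    then have "graph_iso (path_graph 3) (induced_subgraph G {a, b, c})"
      unfolding graph_iso_def induced_subgraph_def
      by (intro exI[of _ f])
        (use ne \<open>a \<noteq> c\<close> in \<open>auto simp: bij_betw_def inj_on_def edges_path_graph_3 verts_path_graph_3 f_def\<close>)
    then show False
      using free S by (auto simp: ind_free_def)
  qed
next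
  assume trans: "\<forall>a b c. {a, b} \<in> edges G \<longrightarrow> {b, c} \<in> edges G \<longrightarrow> a \<noteq> c \<longrightarrow> {a, c} \<in> edges G"
  show "ind_free (path_graph 3) G"
    unfolding ind_free_def
  proof (intro notI, elim exE conjE)
    fix S assume "S \<subseteq> verts G" and "graph_iso (path_graph 3) (induced_subgraph G S)"
    then obtain f where f: "bij_betw f {0, 1, 2} S"
      and E: "{e \<in> edges G. e \<subseteq> S} = {{f 0, f 1}, {f 1, f (2::nat)}}"
      unfolding graph_iso_def induced_subgraph_def
      by (auto simp: edges_path_graph_3 verts_path_graph_3)
    have ne: "f 0 \<noteq> f 2" "f 0 \<noteq> f 1" "f 1 \<noteq> f 2"
      using f by (auto simp: bij_betw_def)
    have "{f 0, f 1} \<in> edges G" "{f 1, f 2} \<in> edges G" "{f 0, f 2} \<subseteq> S"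
      using E f by (auto simp: bij_betw_def)
    then have "{f 0, f 2} \<in> {e \<in> edges G. e \<subseteq> S}"
      using trans ne by blast
    then show False
      using ne unfolding E by (auto simp: doubleton_eq_iff)
  qed
qed

lemma disjoint_two_subsets:
  assumes "A \<inter> B = {}"
  shows "{e. e \<subseteq> A \<and> card e = 2} \<inter> {e. e \<subseteq> B \<and> card e = 2} = {}"
proof -
  have "card e \<noteq> 2" if "e \<subseteq> A" "e \<subseteq> B" for e
  proof -
    have "e = {}" using assms that by blast
    then show ?thesis by simp
  qed
  then show ?thesis by blast
qed

section \<open>Decomposition into disjoint cliques\<close>

locale cluster_graph =
  fixes G :: "'a ugraph"
  assumes simple: "simple_graph G" and P3_free: "ind_free (path_graph 3) G"
begin

abbreviation "clusters \<equiv> nbhd G ` verts G"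

lemma finite_verts: "finite (verts G)"
  using simple by (simp add: simple_graph_def)

lemma finite_clusters: "finite clusters" "C \<in> clusters \<Longrightarrow> finite C" "C \<in> clusters \<Longrightarrow> C \<subseteq> verts G"
  using finite_verts by (auto simp: nbhd_def)

lemma edge_trans: "{a, b} \<in> edges G \<Longrightarrow> {b, c} \<in> edges G \<Longrightarrow> a \<noteq> c \<Longrightarrow> {a, c} \<in> edges G"
  using P3_free ind_free_path_3_iff[OF simple] by blast

text \<open>By transitivity, adjacent vertices have the same closed neighbourhood. Hence these sets
  partition the vertices.\<close>

lemma nbhd_eq_iff: "u \<in> verts G \<Longrightarrow> v \<in> verts G \<Longrightarrow> nbhd G u = nbhd G v \<longleftrightarrow> u \<in> nbhd G v"
proof
  assume "u \<in> verts G" "v \<in> verts G" "u \<in> nbhd G v"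
  show "nbhd G u = nbhd G v"
  proof (cases "u = v")
    case False
    then have uv: "{u, v} \<in> edges G" "{v, u} \<in> edges G"
      using \<open>u \<in> nbhd G v\<close> by (auto simp: nbhd_def insert_commute)
    have "w \<in> nbhd G u \<longleftrightarrow> w \<in> nbhd G v" for w
      using uv edge_trans[of w u v] edge_trans[of w v u] \<open>u \<in> verts G\<close> \<open>v \<in> verts G\<close>
      by (auto simp: nbhd_def)
    then show ?thesis by blast
  qed simp
qed (auto simp: nbhd_def)

text \<open>The edges are recovered from the partition alone, so a vertex bijection that respects
  the partitions is an isomorphism.\<close>

lemma edge_iff:
  "{u, v} \<in> edges G \<longleftrightarrow> u \<in> verts G \<and> v \<in> verts G \<and> u \<noteq> v \<and> nbhd G u = nbhd G v"
proof -
  have "{u, v} \<in> edges G \<longleftrightarrow> u \<in> nbhd G v" if "u \<in> verts G" "u \<noteq> v"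
    using that by (simp add: nbhd_def)
  then show ?thesis
    using edge_verts[OF simple, of u v] nbhd_eq_iff[of u v] by blast
qed

lemma mem_cluster_iff: "C \<in> clusters \<Longrightarrow> v \<in> C \<longleftrightarrow> v \<in> verts G \<and> nbhd G v = C"
proof -
  assume "C \<in> clusters"
  then obtain w where "w \<in> verts G" "C = nbhd G w" by auto
  moreover have "v \<in> nbhd G w \<Longrightarrow> v \<in> verts G"
    by (simp add: nbhd_def)
  ultimately show ?thesis
    using nbhd_eq_iff[of v w] by blast
qed

lemma cluster_edge: "C \<in> clusters \<Longrightarrow> u \<in> C \<Longrightarrow> v \<in> C \<Longrightarrow> u \<noteq> v \<Longrightarrow> {u, v} \<in> edges G"
  by (simp add: edge_iff mem_cluster_iff)

lemma disjoint_clusters: "C \<in> clusters \<Longrightarrow> D \<in> clusters \<Longrightarrow> C \<noteq> D \<Longrightarrow> C \<inter> D = {}"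
  using mem_cluster_iff by (metis disjoint_iff)

lemma card_verts_eq: "card (verts G) = (\<Sum>C\<in>clusters. card C)"
proof -
  have "verts G = (\<Union>C\<in>clusters. C)"
    by (auto simp: nbhd_def)
  then show ?thesis
    using card_UN_disjoint[of clusters "\<lambda>C. C"] finite_clusters disjoint_clusters by simp
qed

text \<open>No edge joins two clusters and each cluster is a clique, so the edge set is the disjoint
  union of the sets of pairs within clusters.\<close>

lemma card_edges_eq: "card (edges G) = (\<Sum>C\<in>clusters. card C choose 2)"
proof -
  have "edges G = (\<Union>C\<in>clusters. {e. e \<subseteq> C \<and> card e = 2})"
  proof (intro equalityI subsetI)
    fix e assume e: "e \<in> edges G"
    obtain u v where uv: "e = {u, v}" "u \<noteq> v" "u \<in> verts G" "v \<in> verts G"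
      using edge_doubleton[OF simple e] .
    then have "e \<subseteq> nbhd G v"
      using e by (auto simp: nbhd_def)
    then show "e \<in> (\<Union>C\<in>clusters. {e. e \<subseteq> C \<and> card e = 2})"
      using uv by auto
  next
    fix e assume "e \<in> (\<Union>C\<in>clusters. {e. e \<subseteq> C \<and> card e = 2})"
    then show "e \<in> edges G"
    proof clarify
      fix v assume v: "v \<in> verts G" "e \<subseteq> nbhd G v" "card e = 2"
      obtain x y where "e = {x, y}" "x \<noteq> y"
        using v(3) by (auto simp: card_2_iff)
      then show "e \<in> edges G"
        using v cluster_edge[of "nbhd G v" x y] by simp
    qed
  qed
  also have "card \<dots> = (\<Sum>C\<in>clusters. card {e. e \<subseteq> C \<and> card e = 2})"
  proof (rule card_UN_disjoint; intro ballI impI finite_clusters)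
    fix C D assume CD: "C \<in> clusters" "D \<in> clusters" "C \<noteq> D"
    show "{e. e \<subseteq> C \<and> card e = 2} \<inter> {e. e \<subseteq> D \<and> card e = 2} = {}"
      by (rule disjoint_two_subsets[OF disjoint_clusters[OF CD]])
  next
    fix C assume "C \<in> clusters"
    then show "finite {e. e \<subseteq> C \<and> card e = 2}"
      using finite_clusters by simp
  qed
  also have "\<dots> = (\<Sum>C\<in>clusters. card C choose 2)"
    by (intro sum.cong) (simp_all add: n_subsets finite_clusters)
  finally show ?thesis .
qed

end

section \<open>Isomorphism from equal clique sizes\<close>

lemma bij_betw_fibres:
  assumes "finite A" "finite B"
    and fibres: "\<And>t. card {a \<in> A. f a = t} = card {b \<in> B. g b = t}"
  obtains \<phi> where "bij_betw \<phi> A B" "\<And>a. a \<in> A \<Longrightarrow> g (\<phi> a) = f a"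
proof -
  have "\<exists>h. bij_betw h {a \<in> A. f a = t} {b \<in> B. g b = t}" for t
    using assms by (intro finite_same_card_bij) auto
  then obtain h where h: "\<And>t. bij_betw (h t) {a \<in> A. f a = t} {b \<in> B. g b = t}"
    by metis
  define \<phi> where "\<phi> a = h (f a) a" for a
  have \<phi>: "\<phi> a \<in> B" "g (\<phi> a) = f a" if "a \<in> A" for a
    using bij_betwE[OF h[of "f a"]] that by (auto simp: \<phi>_def)
  have "bij_betw \<phi> A B"
    unfolding bij_betw_def
  proof (intro conjI inj_onI equalityI subsetI)
    fix x y assume xy: "x \<in> A" "y \<in> A" "\<phi> x = \<phi> y"
    then have "f x = f y" using \<phi> by metis
    then show "x = y"
      using xy bij_betw_imp_inj_on[OF h[of "f x"]] by (auto simp: \<phi>_def inj_on_def)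
  next
    fix b assume "b \<in> B"
    then have "b \<in> h (g b) ` {a \<in> A. f a = g b}"
      using bij_betw_imp_surj_on[OF h[of "g b"]] by auto
    then obtain a where "a \<in> A" "f a = g b" "b = h (g b) a"
      by auto
    then show "b \<in> \<phi> ` A"
      by (intro image_eqI[of _ _ a]) (simp_all add: \<phi>_def)
  qed (use \<phi> in auto)
  then show ?thesis
    using that \<phi>(2) by blast
qed

text \<open>Bijections between fibres are glued twice: first to match clusters of equal size, then
  to match vertices along the matching of clusters.\<close>

lemma cluster_graphs_iso:
  fixes G :: "'a ugraph" and H :: "'b ugraph"
  assumes "cluster_graph G" "cluster_graph H"
    and counts: "\<And>s. card {C \<in> nbhd G ` verts G. card C = s} = card {C \<in> nbhd H ` verts H. card C = s}"
  shows "graph_iso G H"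
proof -
  interpret G: cluster_graph G by fact
  interpret H: cluster_graph H by fact
  obtain \<phi> where \<phi>: "bij_betw \<phi> G.clusters H.clusters" "\<And>C. C \<in> G.clusters \<Longrightarrow> card (\<phi> C) = card C"
    by (rule bij_betw_fibres[OF G.finite_clusters(1) H.finite_clusters(1) counts]) (rule that)
  have \<phi>_eq: "\<phi> C = \<phi> C' \<longleftrightarrow> C = C'" if "C \<in> G.clusters" "C' \<in> G.clusters" for C C'
    using inj_on_eq_iff[OF bij_betw_imp_inj_on[OF \<phi>(1)] that] .
  \<comment> \<open>For a cluster \<open>D\<close> of \<open>H\<close>, the fibres are the cluster
    matched with \<open>D\<close> and \<open>D\<close> itself; for any other \<open>D\<close> both
    are empty.\<close>
  have "card {v \<in> verts G. \<phi> (nbhd G v) = D} = card {w \<in> verts H. nbhd H w = D}" for D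
  proof (cases "D \<in> H.clusters")
    case True
    then have "D \<in> \<phi> ` G.clusters"
      by (simp only: bij_betw_imp_surj_on[OF \<phi>(1)])
    then obtain C where C: "D = \<phi> C" "C \<in> G.clusters"
      by (rule imageE)
    have "{v \<in> verts G. \<phi> (nbhd G v) = D} = {v \<in> verts G. nbhd G v = C}"
      using \<phi>_eq[OF _ C(2)] unfolding C(1) by blast
    also have "\<dots> = C"
      using G.mem_cluster_iff[OF C(2)] by blast
    finally have "{v \<in> verts G. \<phi> (nbhd G v) = D} = C" .
    moreover have "{w \<in> verts H. nbhd H w = D} = D"
      using H.mem_cluster_iff[OF True] by blast
    ultimately show ?thesis
      using \<phi>(2) C by simp
  next
    case False
    then have "{v \<in> verts G. \<phi> (nbhd G v) = D} = {}" "{w \<in> verts H. nbhd H w = D} = {}"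
      using bij_betwE[OF \<phi>(1)] by blast+
    then show ?thesis by (simp only: card.empty)
  qed
  then obtain F where F: "bij_betw F (verts G) (verts H)"
    and nb: "\<And>v. v \<in> verts G \<Longrightarrow> nbhd H (F v) = \<phi> (nbhd G v)"
    by (rule bij_betw_fibres[OF G.finite_verts H.finite_verts]) (rule that)
  have FV: "F v \<in> verts H" if "v \<in> verts G" for v
    using F that by (auto simp: bij_betw_def)
  have edge: "{F u, F v} \<in> edges H \<longleftrightarrow> {u, v} \<in> edges G" if "u \<in> verts G" "v \<in> verts G" for u v
    using that inj_on_eq_iff[OF bij_betw_imp_inj_on[OF F] that]
    by (simp add: G.edge_iff H.edge_iff FV nb \<phi>_eq)
  have "edges H = (`) F ` edges G"
  proof (intro equalityI subsetI)
    fix e assume e: "e \<in> edges H"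
    obtain x y where xy: "e = {x, y}" "x \<in> verts H" "y \<in> verts H"
      using edge_doubleton[OF H.simple e] by metis
    obtain u v where "u \<in> verts G" "v \<in> verts G" "x = F u" "y = F v"
      using xy(2,3) unfolding bij_betw_imp_surj_on[OF F, symmetric] by blast
    then show "e \<in> (`) F ` edges G"
      using edge[of u v] e xy by (intro image_eqI[of _ _ "{u, v}"]) auto
  next
    fix e assume "e \<in> (`) F ` edges G"
    then obtain e' where e': "e = F ` e'" "e' \<in> edges G" by auto
    obtain u v where "e' = {u, v}" "u \<in> verts G" "v \<in> verts G"
      using edge_doubleton[OF G.simple e'(2)] by metis
    then show "e \<in> edges H"
      using edge[of u v] e' by simp
  qed
  then show ?thesis
    using F unfolding graph_iso_def by blast
qed

section \<open>Optimising the clique sizes\<close>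

definition turan_value :: "nat \<Rightarrow> nat" where
  "turan_value n = 6 * (n div 4) + (n mod 4 choose 2)"

text \<open>The quantity \<open>3 * n - 2 * m\<close> equals
  \<open>3 * k1 + 4 * k2 + 3 * k3\<close>, so two cliques of size below 4 make it at least 6. For
  \<open>m = turan_value n\<close> it is 0, 3, 4 or 3, according to the residue of
  \<open>n\<close>.\<close>

lemma cluster_counts_optimal:
  fixes k1 k2 k3 k4 n m :: nat
  assumes n: "k1 + 2 * k2 + 3 * k3 + 4 * k4 = n" and m: "k2 + 3 * k3 + 6 * k4 = m"
  shows "m < turan_value n \<or>
    m = turan_value n \<and> k1 = of_bool (n mod 4 = 1) \<and> k2 = of_bool (n mod 4 = 2) \<and>
      k3 = of_bool (n mod 4 = 3) \<and> k4 = n div 4"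
proof (cases "k1 + k2 + k3 \<ge> 2")
  case True
  define q r where "q = n div 4" and "r = n mod 4"
  have qr: "n = 4 * q + r"
    by (simp add: q_def r_def)
  have "r < 4"
    by (simp add: r_def)
  \<comment> \<open>This says that \<open>3 * n - 2 * m\<close> is below 6 at the claimed
    optimum.\<close>
  then have "3 * r < 2 * (r choose 2) + 6"
    by (auto simp: choose_two less_Suc_eq numeral_eq_Suc)
  then have "m < 6 * q + (r choose 2)"
    using True n m qr by linarith
  then show ?thesis
    by (simp add: turan_value_def q_def r_def)
next
  case False
  \<comment> \<open>The number of vertices outside the 4-cliques. At most one clique contains them,
    so it is below 4 and must be the remainder of \<open>n\<close>.\<close>
  define c where "c = k1 + 2 * k2 + 3 * k3"
  have c: "k1 = of_bool (c = 1) \<and> k2 = of_bool (c = 2) \<and> k3 = of_bool (c = 3) \<and> c < 4"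
  proof -
    consider "k1 = 0 \<and> k2 = 0 \<and> k3 = 0" | "k1 = 1 \<and> k2 = 0 \<and> k3 = 0" | "k1 = 0 \<and> k2 = 1 \<and> k3 = 0"
      | "k1 = 0 \<and> k2 = 0 \<and> k3 = 1"
      using False by linarith
    then show ?thesis
      by cases (simp_all add: c_def)
  qed
  have "n = 4 * k4 + c"
    using n by (simp add: c_def)
  then have dm: "n div 4 = k4" "n mod 4 = c"
    using c by auto
  have "k2 + 3 * k3 = c choose 2"
    using c by (auto simp: choose_two less_Suc_eq numeral_eq_Suc)
  then show ?thesis
    using c m by (simp add: turan_value_def dm)
qed

text \<open>Grouping clusters by size reduces this to the arithmetic of clique counts. The condition
  \<open>s \<noteq> 0\<close> is there because clusters are nonempty: a zero remainder contributes
  no cluster.\<close>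

lemma (in cluster_graph) cluster_sizes_optimal:
  assumes le4: "\<And>C. C \<in> clusters \<Longrightarrow> card C \<le> 4"
  shows "card (edges G) \<le> turan_value (card (verts G))"
    and "card (edges G) = turan_value (card (verts G)) \<Longrightarrow>
      card {C \<in> clusters. card C = s} =
        (if s = 4 then card (verts G) div 4 else of_bool (s = card (verts G) mod 4 \<and> s \<noteq> 0))"
proof -
  define k where "k s = card {C \<in> clusters. card C = s}" for s
  have pos: "card C > 0" if "C \<in> clusters" for C
    using that finite_clusters(2)[OF that] by (auto simp: card_gt_0_iff nbhd_def)
  have k0: "k s = 0" if "s \<notin> {1, 2, 3, 4}" for s
  proof -
    have "card C \<noteq> s" if "C \<in> clusters" for C
      using pos[OF that] le4[OF that] \<open>s \<notin> {1, 2, 3, 4}\<close> by auto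
    then have "{C \<in> clusters. card C = s} = {}" by blast
    then show ?thesis unfolding k_def by (simp only: card.empty)
  qed
  \<comment> \<open>Taking \<open>h\<close> as the identity gives the number of vertices, and as the
    number of pairs the number of edges.\<close>
  have group: "(\<Sum>C\<in>clusters. h (card C)) = k 1 * h 1 + k 2 * h 2 + k 3 * h 3 + k 4 * h 4" for h :: "nat \<Rightarrow> nat"
  proof -
    have "card ` clusters \<subseteq> {1, 2, 3, 4}"
    proof
      fix s assume "s \<in> card ` clusters"
      then show "s \<in> {1, 2, 3, 4}"
        using pos le4 by fastforce
    qed
    then have "(\<Sum>C\<in>clusters. h (card C)) = (\<Sum>s\<in>{1, 2, 3, 4}. \<Sum>C\<in>{C \<in> clusters. card C = s}. h (card C))"
      by (intro sum.group[symmetric] finite_clusters) auto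
    also have "\<dots> = (\<Sum>s\<in>{1, 2, 3, 4}. k s * h s)"
      by (intro sum.cong) (simp_all add: k_def)
    finally show ?thesis by simp
  qed
  have n: "k 1 + 2 * k 2 + 3 * k 3 + 4 * k 4 = card (verts G)"
    using group[of "\<lambda>s. s"] by (simp add: card_verts_eq)
  have m: "k 2 + 3 * k 3 + 6 * k 4 = card (edges G)"
    using group[of "\<lambda>s. s choose 2"] by (simp add: card_edges_eq choose_two)
  show "card (edges G) \<le> turan_value (card (verts G))"
    using cluster_counts_optimal[OF n m] by auto
  assume "card (edges G) = turan_value (card (verts G))"
  then have opt: "k 1 = of_bool (card (verts G) mod 4 = 1) \<and> k 2 = of_bool (card (verts G) mod 4 = 2) \<and>
      k 3 = of_bool (card (verts G) mod 4 = 3) \<and> k 4 = card (verts G) div 4"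
    using cluster_counts_optimal[OF n m] by simp
  have "k s = (if s = 4 then card (verts G) div 4 else of_bool (s = card (verts G) mod 4 \<and> s \<noteq> 0))"
  proof (cases "s \<in> {1, 2, 3, 4}")
    case True
    then show ?thesis using opt by auto
  next
    case False
    moreover have "card (verts G) mod 4 < 4" by simp
    ultimately show ?thesis using k0[OF False] by auto
  qed
  then show "card {C \<in> clusters. card C = s} =
      (if s = 4 then card (verts G) div 4 else of_bool (s = card (verts G) mod 4 \<and> s \<noteq> 0))"
    by (simp add: k_def)
qed

text \<open>Five vertices of a larger clique, together with the curves drawn for their edges, would
  form an arc system on five points.\<close>

lemma planar_clique_card_le_4:
  assumes G: "simple_graph G" "planar G" and W: "W \<subseteq> verts G"
    and clique: "\<And>u v. u \<in> W \<Longrightarrow> v \<in> W \<Longrightarrow> u \<noteq> v \<Longrightarrow> {u, v} \<in> edges G"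
  shows "card W \<le> 4"
proof (rule ccontr)
  assume "\<not> card W \<le> 4"
  then have "5 \<le> card W" by simp
  then obtain W' where W': "W' \<subseteq> W" "card W' = 5" "finite W'"
    by (rule obtain_subset_with_card_n)
  obtain xs where xs: "set xs = W'" "distinct xs"
    using finite_distinct_list[OF W'(3)] by blast
  then have "length xs = 5"
    using W'(2) distinct_card by metis
  then obtain a b c d e where "xs = [a, b, c, d, e]"
    by (auto simp: numeral_eq_Suc length_Suc_conv)
  with xs have W'_eq: "W' = {a, b, c, d, e}" and dist: "distinct [a, b, c, d, e]"
    by auto
  obtain p g where "plane_drawing G p g"
    using G(2) by (auto simp: planar_def)
  then have p: "inj_on p (verts G)"
    and g: "\<And>e. e \<in> edges G \<Longrightarrow> arc (g e) \<and> {pathstart (g e), pathfinish (g e)} = p ` e \<and>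
        path_image (g e) \<inter> p ` verts G = p ` e"
    and gg: "\<And>e e'. e \<in> edges G \<Longrightarrow> e' \<in> edges G \<Longrightarrow> e \<noteq> e' \<Longrightarrow>
        path_image (g e) \<inter> path_image (g e') = p ` (e \<inter> e')"
    unfolding plane_drawing_def by blast+
  have WV: "W' \<subseteq> verts G" using W W' by blast
  have p_eq: "p u = p v \<longleftrightarrow> u = v" if "u \<in> W'" "v \<in> W'" for u v
    using inj_on_eq_iff[OF p] that WV by blast
  \<comment> \<open>Arc systems are indexed by points of the plane, so the vertices have to be
    recovered from their positions.\<close>
  define q where "q = inv_into W' p"
  have q: "q (p v) = v" if "v \<in> W'" for v
    unfolding q_def using that p_eq by (intro inv_into_f_f) (auto simp: inj_on_def)
  \<comment> \<open>A drawing leaves the direction of each curve open; it is reversed here when it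
    does not start at \<open>x\<close>.\<close>
  define A where "A x y = (if pathstart (g {q x, q y}) = x then g {q x, q y} else reversepath (g {q x, q y}))" for x y
  have im: "path_image (A (p u) (p v)) = path_image (g {u, v})" if "u \<in> W'" "v \<in> W'" for u v
    using that by (simp add: A_def q)
  have edge: "{u, v} \<in> edges G" if "u \<in> W'" "v \<in> W'" "u \<noteq> v" for u v
    using that W' clique by blast
  have "arc_system (p ` W') A"
    unfolding arc_system_def
  proof (intro conjI ballI impI; elim imageE; hypsubst)
    fix u v assume uv: "p u \<noteq> p v" "u \<in> W'" "v \<in> W'"
    then have "u \<noteq> v" by blast
    note E = g[OF edge[OF uv(2,3) this]]
    have se: "pathstart (g {u, v}) = p u \<and> pathfinish (g {u, v}) = p v \<or>
        pathstart (g {u, v}) = p v \<and> pathfinish (g {u, v}) = p u"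
      using E by (auto simp: doubleton_eq_iff)
    show "arc (A (p u) (p v))" "pathstart (A (p u) (p v)) = p u" "pathfinish (A (p u) (p v)) = p v"
      using se E uv by (auto simp: A_def q arc_reversepath)
    show "path_image (A (p u) (p v)) = path_image (A (p v) (p u))"
      using uv by (simp add: im insert_commute)
    have "path_image (g {u, v}) \<inter> p ` W' = {p u, p v}"
      using E uv WV by blast
    then show "path_image (A (p u) (p v)) \<inter> p ` W' = {p u, p v}"
      using uv by (simp add: im)
  next
    fix u v x y
    assume *: "p u \<noteq> p v" "p x \<noteq> p y" "{p u, p v} \<noteq> {p x, p y}"
      "u \<in> W'" "v \<in> W'" "x \<in> W'" "y \<in> W'"
    have "path_image (g {u, v}) \<inter> path_image (g {x, y}) = p ` ({u, v} \<inter> {x, y})"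
    proof (rule gg)
      show "{u, v} \<noteq> {x, y}"
        using *(3) by (metis image_empty image_insert)
    qed (use * in \<open>auto intro!: edge\<close>)
    also have "\<dots> = p ` {u, v} \<inter> p ` {x, y}"
      using * WV by (intro inj_on_image_Int[OF p]) auto
    finally show "path_image (A (p u) (p v)) \<inter> path_image (A (p x) (p y)) = {p u, p v} \<inter> {p x, p y}"
      unfolding im[OF *(4,5)] im[OF *(6,7)] image_insert image_empty .
  qed
  then show False
  proof (rule no_arc_system_five)
    show "p ` W' = {p a, p b, p c, p d, p e}"
      by (simp add: W'_eq)
    show "distinct [p a, p b, p c, p d, p e]"
      using dist by (simp add: p_eq W'_eq)
  qed
qed

lemma planar_P3_free_optimal:
  fixes G :: "'a ugraph"
  assumes "G \<in> planar_ind_free_graphs n (path_graph 3)"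
  shows "card (edges G) \<le> turan_value n"
    and "card (edges G) = turan_value n \<Longrightarrow>
      card {C \<in> nbhd G ` verts G. card C = s} = (if s = 4 then n div 4 else of_bool (s = n mod 4 \<and> s \<noteq> 0))"
proof -
  interpret cluster_graph G
    using assms by unfold_locales (auto simp: planar_ind_free_graphs_def)
  have n: "card (verts G) = n" and pl: "planar G"
    using assms by (auto simp: planar_ind_free_graphs_def)
  have "card C \<le> 4" if "C \<in> clusters" for C
    by (rule planar_clique_card_le_4[OF simple pl finite_clusters(3)[OF that] cluster_edge[OF that]])
  note opt = cluster_sizes_optimal[OF this, unfolded n]
  show "card (edges G) \<le> turan_value n"
    by (rule opt)
  show "card (edges G) = turan_value n \<Longrightarrow>
      card {C \<in> nbhd G ` verts G. card C = s} = (if s = 4 then n div 4 else of_bool (s = n mod 4 \<and> s \<noteq> 0))"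
    by (rule opt)
qed

lemma graph_iso_if_optimal:
  assumes "G \<in> planar_ind_free_graphs n (path_graph 3)" "H \<in> planar_ind_free_graphs n (path_graph 3)"
    and "card (edges G) = turan_value n" "card (edges H) = turan_value n"
  shows "graph_iso G H"
proof (rule cluster_graphs_iso)
  show "cluster_graph G" "cluster_graph H"
    using assms by (auto simp: cluster_graph_def planar_ind_free_graphs_def)
qed (simp add: planar_P3_free_optimal(2)[OF assms(1,3)] planar_P3_free_optimal(2)[OF assms(2,4)])

text \<open>The maximum in \<open>ex_planar_ind\<close> ranges over graphs on natural numbers,
  whereas \<open>K4_union\<close> has pairs as vertices. Relabelling along an injection bridges
  this; the drawing is kept by reading labels back through \<open>inv f\<close>.\<close>

lemma planar_P3_free_inj_image:
  fixes f :: "'a \<Rightarrow> 'b"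
  assumes f: "inj f" and G: "G \<in> planar_ind_free_graphs n (path_graph 3)"
  shows "UGraph (f ` verts G) ((`) f ` edges G) \<in> planar_ind_free_graphs n (path_graph 3)"
    (is "?H \<in> _")
proof -
  have simple: "simple_graph G" and n: "card (verts G) = n" and pl: "planar G"
    and free: "ind_free (path_graph 3) G"
    using G by (auto simp: planar_ind_free_graphs_def)
  have simple': "simple_graph ?H"
    using simple f by (auto simp: simple_graph_def card_image inj_on_subset)
  have edge: "{f u, f v} \<in> (`) f ` edges G \<longleftrightarrow> {u, v} \<in> edges G" for u v
  proof -
    have "inj ((`) f)"
      using f by (simp add: inj_def inj_image_eq_iff)
    from inj_image_mem_iff[OF this, of "{u, v}" "edges G"] show ?thesis by simp
  qed
  have "{a, c} \<in> edges ?H" if e: "{a, b} \<in> edges ?H" "{b, c} \<in> edges ?H" "a \<noteq> c" for a b c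
  proof -
    obtain a' b' c' where "a = f a'" "b = f b'" "c = f c'"
      using edge_verts(1,2)[OF simple' e(1)] edge_verts(1,2)[OF simple' e(2)] by auto
    then show ?thesis
      using e free by (simp add: edge ind_free_path_3_iff[OF simple]) blast
  qed
  then have "ind_free (path_graph 3) ?H"
    unfolding ind_free_path_3_iff[OF simple'] by blast
  moreover have "planar ?H"
  proof -
    obtain p g where D: "plane_drawing G p g"
      using pl by (auto simp: planar_def)
    have inv: "inv f ` f ` S = S" "(p \<circ> inv f) ` f ` S = p ` S" for S
      using f by (simp_all add: image_comp comp_assoc)
    have "inj_on (p \<circ> inv f) (f ` verts G)"
      using D f by (auto simp: plane_drawing_def inj_on_def)
    then have "plane_drawing ?H (p \<circ> inv f) (\<lambda>e. g (inv f ` e))"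
      using D f unfolding plane_drawing_def
      by (simp add: inv inj_image_eq_iff del: comp_apply flip: image_Int)
    then show ?thesis
      by (auto simp: planar_def)
  qed
  moreover have "card (verts ?H) = n"
    using n f by (simp add: card_image inj_on_subset)
  ultimately show ?thesis
    using simple' by (simp add: planar_ind_free_graphs_def)
qed

section \<open>Planar drawings of disjoint unions of small cliques\<close>

text \<open>A triangle with its fourth vertex in the interior. The real parts stay between 0 and 4,
  so that translated copies can be kept apart.\<close>

definition K4_point :: "nat \<Rightarrow> complex" where
  "K4_point j = (if j = 0 then Complex 0 0 else if j = 1 then Complex 4 0
     else if j = 2 then Complex 2 4 else Complex 2 1)"

lemma in_segment_Complex:
  assumes "z \<in> closed_segment (Complex a b) (Complex c d)"
  obtains t where "0 \<le> t" "t \<le> 1" "Re z = a + t * (c - a)" "Im z = b + t * (d - b)"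
proof -
  obtain t where "0 \<le> t" "t \<le> 1" and z: "z = (1 - t) *\<^sub>R Complex a b + t *\<^sub>R Complex c d"
    using assms by (auto simp: in_segment)
  then show ?thesis
    by (intro that[of t]) (simp_all add: z algebra_simps)
qed

text \<open>Each edge is described by the equation of its line. The inequalities are what separates
  the three pairs of edges without a common end; edges that share an end lie on distinct lines
  through it.\<close>

lemma K4_segment_cases:
  assumes "j < k" "k < 4" "z \<in> closed_segment (K4_point j) (K4_point k)"
  shows "j = 0 \<and> k = 1 \<and> Im z = 0 \<or>
    j = 0 \<and> k = 2 \<and> Im z = 2 * Re z \<and> Re z \<le> 2 \<or>
    j = 0 \<and> k = 3 \<and> Re z = 2 * Im z \<and> Re z \<le> 2 \<or>
    j = 1 \<and> k = 2 \<and> Im z = 8 - 2 * Re z \<and> 2 \<le> Re z \<or>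
    j = 1 \<and> k = 3 \<and> Re z = 4 - 2 * Im z \<and> 2 \<le> Re z \<or>
    j = 2 \<and> k = 3 \<and> Re z = 2 \<and> 1 \<le> Im z"
proof -
  consider "j = 0 \<and> k = 1" | "j = 0 \<and> k = 2" | "j = 0 \<and> k = 3" | "j = 1 \<and> k = 2" | "j = 1 \<and> k = 3" | "j = 2 \<and> k = 3"
    using assms(1,2) by linarith
  then show ?thesis
    by cases (use assms(3) in \<open>auto simp: K4_point_def elim!: in_segment_Complex\<close>)
qed

lemma K4_segment_Int:
  assumes "j < k" "k < 4" "j' < k'" "k' < 4" "j \<noteq> j' \<or> k \<noteq> k'"
    and z: "z \<in> closed_segment (K4_point j) (K4_point k)" "z \<in> closed_segment (K4_point j') (K4_point k')"
  shows "z \<in> K4_point ` ({j, k} \<inter> {j', k'})"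
  using K4_segment_cases[OF assms(1,2) z(1)] K4_segment_cases[OF assms(3,4) z(2)] assms(5)
  by (elim disjE conjE) (simp_all add: K4_point_def complex_eq_iff)

lemma K4_point_in_segment:
  assumes "j < k" "k < 4" "l < 4" "K4_point l \<in> closed_segment (K4_point j) (K4_point k)"
  shows "l = j \<or> l = k"
proof -
  consider "l = 0" | "l = 1" | "l = 2" | "l = 3"
    using assms(3) by linarith
  then show ?thesis
    by cases (use K4_segment_cases[OF assms(1,2,4)] in \<open>auto simp: K4_point_def\<close>)
qed

lemma K4_point_inj: "j < 4 \<Longrightarrow> k < 4 \<Longrightarrow> K4_point j = K4_point k \<longleftrightarrow> j = k"
  by (auto simp: K4_point_def complex_eq_iff split: if_splits)

lemma Re_K4_point: "0 \<le> Re (K4_point j)" "Re (K4_point j) \<le> 4"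
  by (auto simp: K4_point_def)

lemma Re_K4_segment:
  assumes "z \<in> closed_segment (K4_point j) (K4_point k)"
  shows "0 \<le> Re z" "Re z \<le> 4"
proof -
  have "closed_segment (K4_point j) (K4_point k) \<subseteq> {z. 0 \<le> Re z} \<inter> {z. Re z \<le> 4}"
    by (intro closed_segment_subset convex_Int convex_halfspace_Re_ge convex_halfspace_Re_le)
       (auto simp: Re_K4_point)
  with assms show "0 \<le> Re z" "Re z \<le> 4" by auto
qed

text \<open>Block \<open>i\<close> is a copy of the drawing shifted by \<open>10 * i\<close>. As a
  copy has width 4, different blocks lie in disjoint vertical strips.\<close>

definition block_point :: "nat \<times> nat \<Rightarrow> complex" where
  "block_point v = of_real (10 * real (fst v)) + K4_point (snd v)"

lemma block_eqI:
  assumes "10 * real i \<le> x" "x \<le> 10 * real i + 4" "10 * real i' \<le> x" "x \<le> 10 * real i' + 4"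
  shows "i = i'"
proof -
  have "real i < real i' + 1" "real i' < real i + 1"
    using assms by linarith+
  then show ?thesis by linarith
qed

lemma block_segmentD:
  assumes "z \<in> closed_segment (block_point (i, j)) (block_point (i, k))"
  shows "z - of_real (10 * real i) \<in> closed_segment (K4_point j) (K4_point k)"
    and "10 * real i \<le> Re z" "Re z \<le> 10 * real i + 4"
proof -
  have "of_real (10 * real i) + (z - of_real (10 * real i)) \<in>
      closed_segment (block_point (i, j)) (block_point (i, k))"
    using assms by simp
  then show *: "z - of_real (10 * real i) \<in> closed_segment (K4_point j) (K4_point k)"
    unfolding block_point_def fst_conv snd_conv closed_segment_translation_eq .
  show "10 * real i \<le> Re z" "Re z \<le> 10 * real i + 4"
    using Re_K4_segment[OF *] by simp_all
qed

lemma Re_block_point: "10 * real (fst v) \<le> Re (block_point v)" "Re (block_point v) \<le> 10 * real (fst v) + 4"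
  using Re_K4_point[of "snd v"] by (simp_all add: block_point_def)

section \<open>Disjoint unions of cliques of prescribed sizes\<close>

definition clique_union :: "nat list \<Rightarrow> (nat \<times> nat) ugraph" where
  "clique_union ms = disjoint_union (map complete_graph ms)"

lemma verts_clique_union: "verts (clique_union ms) = (SIGMA i:{..<length ms}. {..<ms ! i})"
  by (auto simp: clique_union_def disjoint_union_def complete_graph_def)

lemma edges_clique_union:
  "edges (clique_union ms) = (\<Union>i<length ms. {e. e \<subseteq> Pair i ` {..<ms ! i} \<and> card e = 2})"
proof -
  have "(`) (Pair i) ` {e. e \<subseteq> S \<and> card e = 2} = {e. e \<subseteq> Pair i ` S \<and> card e = 2}" for i :: nat and S :: "nat set"
  proof (intro equalityI subsetI)
    fix e assume e: "e \<in> {e. e \<subseteq> Pair i ` S \<and> card e = 2}"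
    then obtain e' where "e' \<subseteq> S" "e = Pair i ` e'"
      by (auto simp: subset_image_iff)
    then show "e \<in> (`) (Pair i) ` {e. e \<subseteq> S \<and> card e = 2}"
      using e by (auto simp: card_image inj_on_def)
  qed (auto simp: card_image inj_on_def)
  then show ?thesis
    by (simp add: clique_union_def disjoint_union_def complete_graph_def)
qed

text \<open>The order \<open>j < k\<close> gives each edge a unique representation, matching the
  case distinction for the segments of the drawing.\<close>

lemma edge_clique_unionE:
  assumes "e \<in> edges (clique_union ms)"
  obtains i j k where "e = {(i, j), (i, k)}" "j < k" "i < length ms" "k < ms ! i"
proof -
  obtain i where i: "i < length ms" "e \<subseteq> Pair i ` {..<ms ! i}" "card e = 2"
    using assms by (auto simp: edges_clique_union)
  obtain u v where uv: "e = {u, v}" "u \<noteq> v"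
    using i(3) by (auto simp: card_2_iff)
  obtain j k where "u = (i, j)" "v = (i, k)" "j < ms ! i" "k < ms ! i"
    using i(2) uv(1) by auto
  then show ?thesis
    using that[of i j k] that[of i k j] uv i(1) by (cases "j < k") (auto simp: insert_commute)
qed

lemma edge_clique_union_iff:
  "{u, v} \<in> edges (clique_union ms) \<longleftrightarrow>
    u \<noteq> v \<and> fst u = fst v \<and> u \<in> verts (clique_union ms) \<and> v \<in> verts (clique_union ms)"
  by (cases u; cases v) (auto simp: edges_clique_union verts_clique_union card_insert_if)

lemma simple_clique_union: "simple_graph (clique_union ms)"
  unfolding simple_graph_def
proof (intro conjI ballI)
  show "finite (verts (clique_union ms))"
    by (simp add: verts_clique_union)
  show "card e = 2" if "e \<in> edges (clique_union ms)" for e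
    using that by (auto simp: edges_clique_union)
  show "e \<subseteq> verts (clique_union ms)" if "e \<in> edges (clique_union ms)" for e
    using that by (fastforce simp: edges_clique_union verts_clique_union)
qed

lemma ind_free_clique_union: "ind_free (path_graph 3) (clique_union ms)"
  unfolding ind_free_path_3_iff[OF simple_clique_union] edge_clique_union_iff by auto

lemma card_verts_clique_union: "card (verts (clique_union ms)) = sum_list ms"
  by (simp add: verts_clique_union sum_list_sum_nth atLeast0LessThan)

lemma card_edges_clique_union: "card (edges (clique_union ms)) = (\<Sum>m\<leftarrow>ms. m choose 2)"
proof -
  have "card (edges (clique_union ms)) =
      (\<Sum>i<length ms. card {e. e \<subseteq> Pair i ` {..<ms ! i} \<and> card e = 2})"
    unfolding edges_clique_union
  proof (rule card_UN_disjoint; (intro ballI impI)?)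
    fix i i' :: nat assume "i \<noteq> i'"
    then show "{e. e \<subseteq> Pair i ` {..<ms ! i} \<and> card e = 2} \<inter> {e. e \<subseteq> Pair i' ` {..<ms ! i'} \<and> card e = 2} = {}"
      by (intro disjoint_two_subsets) blast
  qed simp_all
  also have "\<dots> = (\<Sum>i<length ms. ms ! i choose 2)"
    by (intro sum.cong) (simp_all add: n_subsets card_image inj_on_def)
  also have "\<dots> = (\<Sum>m\<leftarrow>ms. m choose 2)"
    by (simp add: sum_list_sum_nth atLeast0LessThan)
  finally show ?thesis .
qed

text \<open>All edges are straight segments. Those in different blocks lie in disjoint strips; those
  in one block reduce by translation to the drawing of the complete graph on four vertices, of which
  every smaller clique uses a part.\<close>

lemma planar_clique_union:
  assumes ms: "\<And>m. m \<in> set ms \<Longrightarrow> m \<le> 4"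
  shows "planar (clique_union ms)"
proof -
  let ?G = "clique_union ms"
  \<comment> \<open>An edge is an unordered pair within a block: the first coordinates agree, so
    \<open>Min\<close> reads off the block, and \<open>Min\<close> and \<open>Max\<close> of the
    second coordinates fix a direction.\<close>
  define g where "g e = linepath (block_point (Min (fst ` e), Min (snd ` e)))
    (block_point (Min (fst ` e), Max (snd ` e)))" for e
  have g: "g {(i, j), (i, k)} = linepath (block_point (i, j)) (block_point (i, k))" if "j < k" for i j k
    using that by (simp add: g_def min_def max_def)
  have lt4: "j < 4" if "i < length ms" "j < ms ! i" for i j
    using ms[OF nth_mem[OF that(1)]] that(2) by simp
  have vlt4: "snd v < 4" if "v \<in> verts ?G" for v
    using that lt4 by (auto simp: verts_clique_union)
  have inj: "inj_on block_point (verts ?G)"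
  proof (rule inj_onI)
    fix u v assume uv: "u \<in> verts ?G" "v \<in> verts ?G" "block_point u = block_point v"
    have "fst u = fst v"
      using block_eqI[OF Re_block_point[of u]] Re_block_point[of v] uv(3) by simp
    then show "u = v"
      using uv vlt4 by (auto simp: block_point_def K4_point_inj prod_eq_iff)
  qed
  have "plane_drawing ?G block_point g"
    unfolding plane_drawing_def
  proof (intro conjI ballI impI inj)
    fix e assume e: "e \<in> edges ?G"
    obtain i j k where ijk: "e = {(i, j), (i, k)}" "j < k" "i < length ms" "k < ms ! i"
      using edge_clique_unionE[OF e] .
    have k4: "k < 4"
      using lt4 ijk by blast
    have "K4_point j \<noteq> K4_point k"
      using K4_point_inj[of j k] ijk k4 by simp
    then show "arc (g e)" "{pathstart (g e), pathfinish (g e)} = block_point ` e"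
      using ijk by (auto simp: g block_point_def)
    show "path_image (g e) \<inter> block_point ` verts ?G = block_point ` e"
    proof (intro equalityI subsetI)
      fix z assume z: "z \<in> path_image (g e) \<inter> block_point ` verts ?G"
      then obtain v where v: "v \<in> verts ?G" "z = block_point v" by auto
      have seg: "z \<in> closed_segment (block_point (i, j)) (block_point (i, k))"
        using z ijk by (simp add: g)
      have "fst v = i"
        using block_eqI[OF Re_block_point[of v]] block_segmentD(2,3)[OF seg] v(2) by simp
      then have "K4_point (snd v) \<in> closed_segment (K4_point j) (K4_point k)"
        using block_segmentD(1)[OF seg] v(2) by (simp add: block_point_def)
      then have "snd v = j \<or> snd v = k"
        using K4_point_in_segment ijk(2) k4 vlt4[OF v(1)] by blast
      then show "z \<in> block_point ` e"
        using v(2) \<open>fst v = i\<close> ijk(1) by (cases v) auto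
    next
      fix z assume "z \<in> block_point ` e"
      moreover have "e \<subseteq> verts ?G"
        using e simple_clique_union by (auto simp: simple_graph_def)
      moreover have "block_point ` e \<subseteq> path_image (g e)"
        using ijk by (simp add: g)
      ultimately show "z \<in> path_image (g e) \<inter> block_point ` verts ?G" by blast
    qed
  next
    fix e e' assume e: "e \<in> edges ?G" "e' \<in> edges ?G" "e \<noteq> e'"
    obtain i j k where ijk: "e = {(i, j), (i, k)}" "j < k" "i < length ms" "k < ms ! i"
      using edge_clique_unionE[OF e(1)] .
    obtain i' j' k' where ijk': "e' = {(i', j'), (i', k')}" "j' < k'" "i' < length ms" "k' < ms ! i'"
      using edge_clique_unionE[OF e(2)] .
    have k4: "k < 4" "k' < 4"
      using lt4 ijk ijk' by blast+
    show "path_image (g e) \<inter> path_image (g e') = block_point ` (e \<inter> e')"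
    proof (intro equalityI subsetI)
      fix z assume "z \<in> path_image (g e) \<inter> path_image (g e')"
      then have seg: "z \<in> closed_segment (block_point (i, j)) (block_point (i, k))"
        "z \<in> closed_segment (block_point (i', j')) (block_point (i', k'))"
        using ijk ijk' by (simp_all add: g)
      \<comment> \<open>A common point determines the strip, hence the block; distinct edges must
        then differ within the block.\<close>
      have i: "i' = i"
        using block_eqI block_segmentD(2,3)[OF seg(1)] block_segmentD(2,3)[OF seg(2)] by blast
      then have "j \<noteq> j' \<or> k \<noteq> k'"
        using e(3) ijk(1) ijk'(1) by blast
      then have "z - of_real (10 * real i) \<in> K4_point ` ({j, k} \<inter> {j', k'})"
        using K4_segment_Int ijk(2) ijk'(2) k4 block_segmentD(1)[OF seg(1)] block_segmentD(1)[OF seg(2)] i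
        by blast
      then obtain l where l: "l \<in> {j, k}" "l \<in> {j', k'}" "z - of_real (10 * real i) = K4_point l"
        by blast
      then have "z = block_point (i, l)" "(i, l) \<in> e \<inter> e'"
        using ijk(1) ijk'(1) i by (auto simp: block_point_def algebra_simps)
      then show "z \<in> block_point ` (e \<inter> e')" by blast
    next
      fix z assume "z \<in> block_point ` (e \<inter> e')"
      moreover have "block_point ` e \<subseteq> path_image (g e)" "block_point ` e' \<subseteq> path_image (g e')"
        using ijk ijk' by (simp_all add: g)
      ultimately show "z \<in> path_image (g e) \<inter> path_image (g e')" by blast
    qed
  qed
  then show ?thesis
    by (auto simp: planar_def)
qed

section \<open>Extremal graphs\<close>

lemma K4_union_eq_clique_union:
  "K4_union n = clique_union (replicate (n div 4) 4 @ (if 4 dvd n then [] else [n mod 4]))"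
  by (simp add: K4_union_def clique_union_def minus_mult_div_eq_mod)

lemma K4_union_planar_P3_free: "K4_union n \<in> planar_ind_free_graphs n (path_graph 3)"
proof -
  have "planar (K4_union n)"
    unfolding K4_union_eq_clique_union by (rule planar_clique_union) (auto split: if_splits)
  moreover have "card (verts (K4_union n)) = n"
    by (simp add: K4_union_eq_clique_union card_verts_clique_union sum_list_replicate
        mod_eq_0_iff_dvd)
  ultimately show ?thesis
    by (simp add: planar_ind_free_graphs_def K4_union_eq_clique_union simple_clique_union ind_free_clique_union)
qed

lemma card_edges_K4_union: "card (edges (K4_union n)) = turan_value n"
  by (simp add: K4_union_eq_clique_union card_edges_clique_union sum_list_replicate turan_value_def
      choose_two mod_eq_0_iff_dvd)

lemma ex_planar_ind_path_3: "ex_planar_ind n (path_graph 3) = turan_value n"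
  unfolding ex_planar_ind_def
proof (rule Max_eqI)
  let ?S = "(\<lambda>G. card (edges G)) ` (planar_ind_free_graphs n (path_graph 3) :: nat ugraph set)"
  have le: "m \<le> turan_value n" if "m \<in> ?S" for m
    using that planar_P3_free_optimal(1) by auto
  \<comment> \<open>The uniform bound on edge numbers already makes the set finite, as required for
    \<open>Max\<close>.\<close>
  then show "finite ?S"
    by (meson finite_nat_set_iff_bounded_le)
  show "\<And>m. m \<in> ?S \<Longrightarrow> m \<le> turan_value n" by (rule le)
  \<comment> \<open>The encoding of pairs turns \<open>K4_union n\<close> into a graph on natural
    numbers with the same number of edges, which attains the bound.\<close>
  let ?f = "to_nat :: nat \<times> nat \<Rightarrow> nat"
  have "card ((`) ?f ` edges (K4_union n)) = turan_value n"
    by (simp add: card_image inj_on_def inj_image_eq_iff card_edges_K4_union)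
  then show "turan_value n \<in> ?S"
    using planar_P3_free_inj_image[OF inj_to_nat K4_union_planar_P3_free, of n]
    by (force intro!: image_eqI)
qed

theorem theorem1p2:
  fixes n :: nat
  assumes "n \<ge> 1"
  shows "real (ex_planar_ind n (path_graph 3)) =
           (if n mod 4 = 0 then 6 / 4 * real n
            else if n mod 4 = 1 then 6 / 4 * (real n - 1)
            else if n mod 4 = 2 then 6 / 4 * (real n - 2) + 1
            else 6 / 4 * (real n - 3) + 3) \<and>
         extremal_graph n (path_graph 3) (K4_union n) \<and>
         (\<forall>G :: 'a ugraph. extremal_graph n (path_graph 3) G \<longrightarrow> graph_iso G (K4_union n))"
proof (intro conjI allI impI)
  define q r where "q = n div 4" and "r = n mod 4"
  have n: "n = 4 * q + r"
    by (simp add: q_def r_def)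
  have "r < 4"
    by (simp add: r_def)
  \<comment> \<open>For these residues \<open>r choose 2\<close> is 0, 0, 1 and 3, the additive
    constants of the four formulas.\<close>
  then consider "r = 0" | "r = 1" | "r = 2" | "r = 3"
    by linarith
  moreover have "turan_value n = 6 * q + (r choose 2)"
    by (simp add: turan_value_def q_def r_def)
  ultimately show "real (ex_planar_ind n (path_graph 3)) =
           (if n mod 4 = 0 then 6 / 4 * real n
            else if n mod 4 = 1 then 6 / 4 * (real n - 1)
            else if n mod 4 = 2 then 6 / 4 * (real n - 2) + 1
            else 6 / 4 * (real n - 3) + 3)"
    unfolding ex_planar_ind_path_3 r_def[symmetric]
    by cases (simp_all add: n choose_two)
  show "extremal_graph n (path_graph 3) (K4_union n)"
    by (simp add: extremal_graph_def K4_union_planar_P3_free card_edges_K4_union ex_planar_ind_path_3)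
  show "graph_iso G (K4_union n)" if "extremal_graph n (path_graph 3) G" for G :: "'a ugraph"
    using that unfolding extremal_graph_def ex_planar_ind_path_3
    by (blast intro: graph_iso_if_optimal K4_union_planar_P3_free card_edges_K4_union)
qed

end
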